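(* Let $(\mathsf{FP}_1^{\mathsf{NL}})$ be the fluid problem under the nested logit model and $(\mathsf{FP}_2^{\mathsf{NL}})$ the associated convex program, as defined in the context. Suppose that the following two conditions hold. Condition (i): for any feasible solution $(d,p,p_0,v_\le,u_>)$ of $(\mathsf{FP}_2^{\mathsf{NL}})$ at which $$\Big(\tfrac1{\gamma_{it}}-1\Big)p_{it}\ln\Big(\tfrac{p_{0t}}{p_{it}}\Big)+\sum_{j\in\mathcal J_i}d_{jt}\ln\Big(\tfrac{p_{0t}}{d_{jt}}\Big)=\sum_{k\in\mathcal K'_{it}}v_{ikt}\quad\forall i\in\mathcal I_\le,\ t=0,\dots,T,$$ the system $$\Big(\tfrac1{\gamma_{it}}-1\Big)d_{jt}\ln\Big(\tfrac{p_{0t}}{p_{it}}\Big)+d_{jt}\ln\Big(\tfrac{p_{0t}}{d_{jt}}\Big)=\sum_{k\in\mathcal K_{jt}}u_{jkt}\quad\forall i\in\mathcal I_\le,\ j\in\mathcal J_i,\ t=0,\dots,T,$$ $$v_{ikt}=\sum_{j\in\mathcal J'_{ikt}}u_{jkt}\quad\forall i\in\mathcal I_\le,\ k\in\mathcal K'_{it},\ t=0,\dots,T,$$ $$u_{jkt}\ge\underline x_{jkt}d_{jt}\quad\forall j\in\mathcal J_\le,\ k\in\underline{\mathcal K}_{jt},\ t=0,\dots,T,$$ $$u_{jkt}\le\overline x_{jkt}d_{jt}\quad\forall j\in\mathcal J_\le,\ k\in\overline{\mathcal K}_{jt},\ t=0,\dots,T$$ has a solution $u_\le=(u_{jkt})_{j\in\mathcal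 J_\le,k\in\mathcal K_{jt},t}$, where $\mathcal J'_{ikt}:=\{j\in\mathcal J_i:k\in\mathcal K_{jt}\}$. Condition (ii): $\overline{\mathcal K}_{jt}\subsetneq\mathcal K_{jt}$ for every $j\in\mathcal J_>$ and $t\in\{0,\dots,T\}$. Then: 1. If $(\mathsf{FP}_2^{\mathsf{NL}})$ is infeasible, then $(\mathsf{FP}_1^{\mathsf{NL}})$ is infeasible. 2. If $(\mathsf{FP}_2^{\mathsf{NL}})$ is feasible and unbounded, then $(\mathsf{FP}_1^{\mathsf{NL}})$ is feasible and unbounded. 3. If $(\mathsf{FP}_2^{\mathsf{NL}})$ has an optimal solution $(d^*,p^*,p_0^*,v_\le^*,u_>^* )$, then $(d^*,p^*,x^* )$ with $x^*_{jkt}=u^*_{jkt}/d^*_{jt}$ for every $j\in\mathcal J$, $t\in\{0,\dots,T\}$, $k\in\mathcal K_{jt}$ is an optimal solution of $(\mathsf{FP}_1^{\mathsf{NL}})$, where $u^*_{jkt}$ for $j\in\mathcal J_>$ is the corresponding component of $u_>^*$, and $u^*_{jkt}$ for $j\in\mathcal J_\le$ is obtained by solving the system in Condition (i) with $(d^*,p^*,p_0^*,v_\le^*,u_>^* )$ as input.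
   Context: $T\ge0$ is an integer; $\mathcal J$ is a finite nonempty set (products), $\mathcal R$ a finite set (resources). $\mathcal I$ is a finite set (nests), and $\{\mathcal J_i\}_{i\in\mathcal I}$ is a partition of $\mathcal J$ into nonempty sets. For each $j\in\mathcal J$ and $t\in\{0,\dots,T\}$, $\mathcal K_{jt}$ is a finite nonempty set (attributes); these sets may overlap for different $j$. $\underline{\mathcal K}_{jt}\subseteq\mathcal K_{jt}$ is the set of attributes with a lower bound $\underline x_{jkt}\in\mathbb R$, $\overline{\mathcal K}_{jt}\subseteq\mathcal K_{jt}$ the set of attributes with an upper bound $\overline x_{jkt}\in\mathbb R$, and $\underline x_{jkt}\le\overline x_{jkt}$ for $k\in\underline{\mathcal K}_{jt}\cap\overline{\mathcal K}_{jt}$. For $i\in\mathcal I$ (and each $t$), $\overline{\mathcal J}_i=\{j\in\mathcal J_i:\overline{\mathcal K}_{jt}=\mathcal K_{jt}\}$ (dependence on $t$ suppressed), $\overline{\mathcal K}'_{it}:=\bigcap_{j\in\mathcal J_i}\overline{\mathcal K}_{jt}$, $\underline{\mathcal K}'_{it}:=\bigcap_{j\in\mathcal J_i}\underline{\mathcal K}_{jt}$, $\mathcal K'_{it}:=\bigcup_{j\in\mathcal J_i}\mathcal K_{jt}$. Parameters: $\lambda_t>0$ (expected number of arrivals in period $t$), $\phi_{kt}>0$, $\psi_{jt},a_{rj},b_r\in\mathbb R$, and nest dissimilarity parameters $\gamma_{it}>0$. Each nest $i$ is of one of two types: $\mathcal I_\le$ is the set of $i$ with $\gamma_{it}\le1$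 (for all $t$), $\mathcal I_>$ the set of $i$ with $\gamma_{it}>1$ (for all $t$), and $\mathcal I=\mathcal I_\le\cup\mathcal I_>$. $\mathcal J_\le:=\bigcup_{i\in\mathcal I_\le}\mathcal J_i$, $\mathcal J_>:=\bigcup_{i\in\mathcal I_>}\mathcal J_i$. A maximization problem is "unbounded" if it is feasible and its objective is not bounded above on the feasible set. $(\mathsf{FP}_1^{\mathsf{NL}})$, in the real variables $d=(d_{jt})$, $p=(p_{it})$, $x=(x_{jkt})$: $$\max_{d,p,x}\ \sum_{t=0}^T\lambda_t\sum_{j\in\mathcal J}\Big(\sum_{k\in\mathcal K_{jt}}\phi_{kt}x_{jkt}-\psi_{jt}\Big)d_{jt}$$ subject to $$d_{jt}=p_{it}\,\frac{\exp(-\sum_{k\in\mathcal K_{jt}}x_{jkt})}{\sum_{j'\in\mathcal J_i}\exp(-\sum_{k\in\mathcal K_{j't}}x_{j'kt})}\quad\forall i\in\mathcal I,\ j\in\mathcal J_i,\ t;$$ $$p_{it}=\frac{\big(\sum_{j'\in\mathcal J_i}\exp(-\sum_{k\in\mathcal K_{j't}}x_{j'kt})\big)^{\gamma_{it}}}{1+\sum_{i'\in\mathcal I}\big(\sum_{j'\in\mathcal J_{i'}}\exp(-\sum_{k\in\mathcal K_{j't}}x_{j'kt})\big)^{\gamma_{i't}}}\quad\forall i\in\mathcal I,\ t;$$ $\sum_{t}\lambda_t\sum_{j}a_{rj}d_{jt}\le b_r$ for all $r\in\mathcal R$; $x_{jkt}\ge\underline x_{jkt}$ for all $j,t$, $k\in\underline{\mathcal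 K}_{jt}$; $x_{jkt}\le\overline x_{jkt}$ for all $j,t$, $k\in\overline{\mathcal K}_{jt}$. $(\mathsf{FP}_2^{\mathsf{NL}})$, in the real variables $d=(d_{jt})_{j\in\mathcal J,t}$, $p=(p_{it})_{i\in\mathcal I,t}$, $p_0=(p_{0t})_t$, $v_\le=(v_{ikt})_{i\in\mathcal I_\le,k\in\mathcal K'_{it},t}$, $u_>=(u_{jkt})_{j\in\mathcal J_>,k\in\mathcal K_{jt},t}$: $$\max\ \sum_{t}\lambda_t\sum_{i\in\mathcal I_\le}\sum_{k\in\mathcal K'_{it}}\phi_{kt}v_{ikt}+\sum_t\lambda_t\sum_{j\in\mathcal J_>}\sum_{k\in\mathcal K_{jt}}\phi_{kt}u_{jkt}-\sum_t\lambda_t\sum_{j\in\mathcal J}\psi_{jt}d_{jt}$$ subject to $\sum_{t}\lambda_t\sum_{j}a_{rj}d_{jt}\le b_r$ for all $r\in\mathcal R$ and, for all $t=0,\dots,T$: $(\frac1{\gamma_{it}}-1)p_{it}\ln(p_{0t}/p_{it})+\sum_{j\in\mathcal J_i}d_{jt}\ln(p_{0t}/d_{jt})\ge\sum_{k\in\mathcal K'_{it}}v_{ikt}$ for all $i\in\mathcal I_\le$; $(\frac1{\gamma_{it}}-1)p_{0t}\ln(p_{0t}/p_{it})+p_{0t}\ln(p_{0t}/d_{jt})\le p_{0t}\sum_{k\in\mathcal K_{jt}}\overline x_{jkt}$ for all $i\in\mathcal I_\le$, $j\in\overline{\mathcal J}_i$; $(1-\frac1{\gamma_{it}})d_{jt}\ln(p_{it}/d_{jt})+\frac1{\gamma_{it}}d_{jt}\ln(p_{0t}/d_{jt})\ge\sum_{k\in\mathcal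 K_{jt}}u_{jkt}$ for all $i\in\mathcal I_>$, $j\in\mathcal J_i$; $p_{0t}+\sum_{i\in\mathcal I}p_{it}=1$; $p_{it}=\sum_{j\in\mathcal J_i}d_{jt}$ for all $i\in\mathcal I$; $d_{jt}>0$ for all $j\in\mathcal J$, and $p_{0t}>0$ (so that the logarithms are defined); $v_{ikt}\ge\sum_{j\in\mathcal J_i}\underline x_{jkt}d_{jt}$ for all $i\in\mathcal I_\le$, $k\in\underline{\mathcal K}'_{it}$; $v_{ikt}\le\sum_{j\in\mathcal J_i}\overline x_{jkt}d_{jt}$ for all $i\in\mathcal I_\le$, $k\in\overline{\mathcal K}'_{it}$; $u_{jkt}\ge\underline x_{jkt}d_{jt}$ for all $j\in\mathcal J_>$, $k\in\underline{\mathcal K}_{jt}$; $u_{jkt}\le\overline x_{jkt}d_{jt}$ for all $j\in\mathcal J_>$, $k\in\overline{\mathcal K}_{jt}$. *)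

theory Defs
  imports Complex_Main "HOL-Library.Disjoint_Sets"
begin

text \<open>
  Periods are the natural numbers \<open>t \<le> horizon P\<close>.  All families (data and decision variables) are
  total functions; every constraint and objective below reads them only at the indices at which
  the corresponding quantity exists, so values at other indices are irrelevant.  Argument order
  follows the subscripts, e.g. \<open>x j k t\<close> is \<open>x\<^sub>j\<^sub>k\<^sub>t\<close>.
\<close>

record ('j, 'r, 'i, 'k) nl_data =
  horizon   :: nat                              \<comment> \<open>\<open>T\<close>\<close>
  products  :: "'j set"                         \<comment> \<open>\<open>J\<close>\<close>
  resources :: "'r set"                         \<comment> \<open>\<open>R\<close>\<close>
  nests     :: "'i set"                         \<comment> \<open>\<open>I\<close>\<close>
  nest      :: "'i \<Rightarrow> 'j set"                  \<comment> \<open>\<open>J\<^sub>i\<close>\<close>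
  attrs     :: "'j \<Rightarrow> nat \<Rightarrow> 'k set"          \<comment> \<open>\<open>K\<^sub>j\<^sub>t\<close>\<close>
  lb_attrs  :: "'j \<Rightarrow> nat \<Rightarrow> 'k set"          \<comment> \<open>attributes with a lower bound\<close>
  ub_attrs  :: "'j \<Rightarrow> nat \<Rightarrow> 'k set"          \<comment> \<open>attributes with an upper bound\<close>
  lb        :: "'j \<Rightarrow> 'k \<Rightarrow> nat \<Rightarrow> real"
  ub        :: "'j \<Rightarrow> 'k \<Rightarrow> nat \<Rightarrow> real"
  arrivals  :: "nat \<Rightarrow> real"                   \<comment> \<open>\<open>\<lambda>\<^sub>t\<close>\<close>
  phi       :: "'k \<Rightarrow> nat \<Rightarrow> real"
  psi       :: "'j \<Rightarrow> nat \<Rightarrow> real"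
  usage     :: "'r \<Rightarrow> 'j \<Rightarrow> real"             \<comment> \<open>\<open>a\<^sub>r\<^sub>j\<close>\<close>
  capacity  :: "'r \<Rightarrow> real"                    \<comment> \<open>\<open>b\<^sub>r\<close>\<close>
  dissim    :: "'i \<Rightarrow> nat \<Rightarrow> real"            \<comment> \<open>\<open>\<gamma>\<^sub>i\<^sub>t\<close>\<close>

definition nests_le :: "('j, 'r, 'i, 'k, 'z) nl_data_scheme \<Rightarrow> 'i set" where
  "nests_le P = {i \<in> nests P. \<forall>t\<le>horizon P. dissim P i t \<le> 1}"

definition nests_gt :: "('j, 'r, 'i, 'k, 'z) nl_data_scheme \<Rightarrow> 'i set" where
  "nests_gt P = {i \<in> nests P. \<forall>t\<le>horizon P. dissim P i t > 1}"

definition products_le :: "('j, 'r, 'i, 'k, 'z) nl_data_scheme \<Rightarrow> 'j set" where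
  "products_le P = (\<Union>i\<in>nests_le P. nest P i)"

definition products_gt :: "('j, 'r, 'i, 'k, 'z) nl_data_scheme \<Rightarrow> 'j set" where
  "products_gt P = (\<Union>i\<in>nests_gt P. nest P i)"

definition capped_products :: "('j, 'r, 'i, 'k, 'z) nl_data_scheme \<Rightarrow> 'i \<Rightarrow> nat \<Rightarrow> 'j set" where
  "capped_products P i t = {j \<in> nest P i. ub_attrs P j t = attrs P j t}"

definition nest_attrs :: "('j, 'r, 'i, 'k, 'z) nl_data_scheme \<Rightarrow> 'i \<Rightarrow> nat \<Rightarrow> 'k set" where
  "nest_attrs P i t = (\<Union>j\<in>nest P i. attrs P j t)"

definition nest_lb_attrs :: "('j, 'r, 'i, 'k, 'z) nl_data_scheme \<Rightarrow> 'i \<Rightarrow> nat \<Rightarrow> 'k set" where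
  "nest_lb_attrs P i t = (\<Inter>j\<in>nest P i. lb_attrs P j t)"

definition nest_ub_attrs :: "('j, 'r, 'i, 'k, 'z) nl_data_scheme \<Rightarrow> 'i \<Rightarrow> nat \<Rightarrow> 'k set" where
  "nest_ub_attrs P i t = (\<Inter>j\<in>nest P i. ub_attrs P j t)"

definition products_with :: "('j, 'r, 'i, 'k, 'z) nl_data_scheme \<Rightarrow> 'i \<Rightarrow> 'k \<Rightarrow> nat \<Rightarrow> 'j set" where
  "products_with P i k t = {j \<in> nest P i. k \<in> attrs P j t}"

locale nested_logit =
  fixes P :: "('j, 'r, 'i, 'k, 'z) nl_data_scheme"
  assumes finite_products: "finite (products P)"
    and products_nonempty: "products P \<noteq> {}"
    and finite_resources: "finite (resources P)"
    and finite_nests: "finite (nests P)"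
    and nest_nonempty: "i \<in> nests P \<Longrightarrow> nest P i \<noteq> {}"
    and nest_disjoint: "disjoint_family_on (nest P) (nests P)"
    and nest_cover: "(\<Union>i\<in>nests P. nest P i) = products P"
    and finite_attrs: "\<lbrakk>j \<in> products P; t \<le> horizon P\<rbrakk> \<Longrightarrow> finite (attrs P j t)"
    and attrs_nonempty: "\<lbrakk>j \<in> products P; t \<le> horizon P\<rbrakk> \<Longrightarrow> attrs P j t \<noteq> {}"
    and lb_attrs_subset: "\<lbrakk>j \<in> products P; t \<le> horizon P\<rbrakk> \<Longrightarrow> lb_attrs P j t \<subseteq> attrs P j t"
    and ub_attrs_subset: "\<lbrakk>j \<in> products P; t \<le> horizon P\<rbrakk> \<Longrightarrow> ub_attrs P j t \<subseteq> attrs P j t"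
    and lb_le_ub: "\<lbrakk>j \<in> products P; t \<le> horizon P; k \<in> lb_attrs P j t \<inter> ub_attrs P j t\<rbrakk>
      \<Longrightarrow> lb P j k t \<le> ub P j k t"
    and arrivals_pos: "t \<le> horizon P \<Longrightarrow> arrivals P t > 0"
    and phi_pos: "\<lbrakk>t \<le> horizon P; j \<in> products P; k \<in> attrs P j t\<rbrakk> \<Longrightarrow> phi P k t > 0"
    and dissim_pos: "\<lbrakk>i \<in> nests P; t \<le> horizon P\<rbrakk> \<Longrightarrow> dissim P i t > 0"
    and nest_types: "nests P = nests_le P \<union> nests_gt P"

definition resource_feasible ::
  "('j, 'r, 'i, 'k, 'z) nl_data_scheme \<Rightarrow> ('j \<Rightarrow> nat \<Rightarrow> real) \<Rightarrow> bool" where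
  "resource_feasible P d \<longleftrightarrow> (\<forall>r\<in>resources P.
     (\<Sum>t\<le>horizon P. arrivals P t * (\<Sum>j\<in>products P. usage P r j * d j t)) \<le> capacity P r)"

definition nest_weight ::
  "('j, 'r, 'i, 'k, 'z) nl_data_scheme \<Rightarrow> ('j \<Rightarrow> 'k \<Rightarrow> nat \<Rightarrow> real) \<Rightarrow> 'i \<Rightarrow> nat \<Rightarrow> real" where
  "nest_weight P x i t = (\<Sum>j\<in>nest P i. exp (- (\<Sum>k\<in>attrs P j t. x j k t)))"

definition FP1_feasible :: "('j, 'r, 'i, 'k, 'z) nl_data_scheme \<Rightarrow>
  (('j \<Rightarrow> nat \<Rightarrow> real) \<times> ('i \<Rightarrow> nat \<Rightarrow> real) \<times> ('j \<Rightarrow> 'k \<Rightarrow> nat \<Rightarrow> real)) set" where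
  "FP1_feasible P = {(d, p, x).
     (\<forall>t\<le>horizon P. \<forall>i\<in>nests P. \<forall>j\<in>nest P i.
        d j t = p i t * (exp (- (\<Sum>k\<in>attrs P j t. x j k t)) / nest_weight P x i t)) \<and>
     (\<forall>t\<le>horizon P. \<forall>i\<in>nests P.
        p i t = nest_weight P x i t powr dissim P i t /
          (1 + (\<Sum>i'\<in>nests P. nest_weight P x i' t powr dissim P i' t))) \<and>
     resource_feasible P d \<and>
     (\<forall>t\<le>horizon P. \<forall>j\<in>products P. \<forall>k\<in>lb_attrs P j t. x j k t \<ge> lb P j k t) \<and>
     (\<forall>t\<le>horizon P. \<forall>j\<in>products P. \<forall>k\<in>ub_attrs P j t. x j k t \<le> ub P j k t)}"

definition FP1_objective :: "('j, 'r, 'i, 'k, 'z) nl_data_scheme \<Rightarrow>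
  (('j \<Rightarrow> nat \<Rightarrow> real) \<times> ('i \<Rightarrow> nat \<Rightarrow> real) \<times> ('j \<Rightarrow> 'k \<Rightarrow> nat \<Rightarrow> real)) \<Rightarrow> real" where
  "FP1_objective P = (\<lambda>(d, p, x).
     \<Sum>t\<le>horizon P. arrivals P t *
       (\<Sum>j\<in>products P. ((\<Sum>k\<in>attrs P j t. phi P k t * x j k t) - psi P j t) * d j t))"

text \<open>Positivity of \<open>p i t\<close>, and hence of every argument of \<open>ln\<close>, follows from \<open>d j t > 0\<close> and
  \<open>p i t = (\<Sum>j\<in>nest P i. d j t)\<close>, since nests are nonempty.\<close>

definition FP2_feasible :: "('j, 'r, 'i, 'k, 'z) nl_data_scheme \<Rightarrow>
  (('j \<Rightarrow> nat \<Rightarrow> real) \<times> ('i \<Rightarrow> nat \<Rightarrow> real) \<times> (nat \<Rightarrow> real) \<times>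
   ('i \<Rightarrow> 'k \<Rightarrow> nat \<Rightarrow> real) \<times> ('j \<Rightarrow> 'k \<Rightarrow> nat \<Rightarrow> real)) set" where
  "FP2_feasible P = {(d, p, p0, v, u).
     resource_feasible P d \<and>
     (\<forall>t\<le>horizon P.
       (\<forall>i\<in>nests_le P.
          (1 / dissim P i t - 1) * p i t * ln (p0 t / p i t)
            + (\<Sum>j\<in>nest P i. d j t * ln (p0 t / d j t))
          \<ge> (\<Sum>k\<in>nest_attrs P i t. v i k t)) \<and>
       (\<forall>i\<in>nests_le P. \<forall>j\<in>capped_products P i t.
          (1 / dissim P i t - 1) * p0 t * ln (p0 t / p i t) + p0 t * ln (p0 t / d j t)
          \<le> p0 t * (\<Sum>k\<in>attrs P j t. ub P j k t)) \<and>
       (\<forall>i\<in>nests_gt P. \<forall>j\<in>nest P i.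
          (1 - 1 / dissim P i t) * d j t * ln (p i t / d j t)
            + 1 / dissim P i t * d j t * ln (p0 t / d j t)
          \<ge> (\<Sum>k\<in>attrs P j t. u j k t)) \<and>
       p0 t + (\<Sum>i\<in>nests P. p i t) = 1 \<and>
       (\<forall>i\<in>nests P. p i t = (\<Sum>j\<in>nest P i. d j t)) \<and>
       (\<forall>j\<in>products P. d j t > 0) \<and>
       p0 t > 0 \<and>
       (\<forall>i\<in>nests_le P. \<forall>k\<in>nest_lb_attrs P i t.
          v i k t \<ge> (\<Sum>j\<in>nest P i. lb P j k t * d j t)) \<and>
       (\<forall>i\<in>nests_le P. \<forall>k\<in>nest_ub_attrs P i t.
          v i k t \<le> (\<Sum>j\<in>nest P i. ub P j k t * d j t)) \<and>
       (\<forall>j\<in>products_gt P. \<forall>k\<in>lb_attrs P j t. u j k t \<ge> lb P j k t * d j t) \<and>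
       (\<forall>j\<in>products_gt P. \<forall>k\<in>ub_attrs P j t. u j k t \<le> ub P j k t * d j t))}"

definition FP2_objective :: "('j, 'r, 'i, 'k, 'z) nl_data_scheme \<Rightarrow>
  (('j \<Rightarrow> nat \<Rightarrow> real) \<times> ('i \<Rightarrow> nat \<Rightarrow> real) \<times> (nat \<Rightarrow> real) \<times>
   ('i \<Rightarrow> 'k \<Rightarrow> nat \<Rightarrow> real) \<times> ('j \<Rightarrow> 'k \<Rightarrow> nat \<Rightarrow> real)) \<Rightarrow> real" where
  "FP2_objective P = (\<lambda>(d, p, p0, v, u).
     (\<Sum>t\<le>horizon P. arrivals P t *
        (\<Sum>i\<in>nests_le P. \<Sum>k\<in>nest_attrs P i t. phi P k t * v i k t))
     + (\<Sum>t\<le>horizon P. arrivals P t *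
        (\<Sum>j\<in>products_gt P. \<Sum>k\<in>attrs P j t. phi P k t * u j k t))
     - (\<Sum>t\<le>horizon P. arrivals P t * (\<Sum>j\<in>products P. psi P j t * d j t)))"

definition FP2_tight :: "('j, 'r, 'i, 'k, 'z) nl_data_scheme \<Rightarrow>
  ('j \<Rightarrow> nat \<Rightarrow> real) \<Rightarrow> ('i \<Rightarrow> nat \<Rightarrow> real) \<Rightarrow> (nat \<Rightarrow> real) \<Rightarrow>
  ('i \<Rightarrow> 'k \<Rightarrow> nat \<Rightarrow> real) \<Rightarrow> bool" where
  "FP2_tight P d p p0 v \<longleftrightarrow> (\<forall>t\<le>horizon P. \<forall>i\<in>nests_le P.
     (1 / dissim P i t - 1) * p i t * ln (p0 t / p i t)
       + (\<Sum>j\<in>nest P i. d j t * ln (p0 t / d j t))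
     = (\<Sum>k\<in>nest_attrs P i t. v i k t))"

text \<open>The system in the unknowns \<open>u j k t\<close>, \<open>j \<in> products_le P\<close>, that splits the aggregated
  variables \<open>v\<close> of a nest into contributions of its products.\<close>

definition disaggregates :: "('j, 'r, 'i, 'k, 'z) nl_data_scheme \<Rightarrow>
  ('j \<Rightarrow> nat \<Rightarrow> real) \<Rightarrow> ('i \<Rightarrow> nat \<Rightarrow> real) \<Rightarrow> (nat \<Rightarrow> real) \<Rightarrow>
  ('i \<Rightarrow> 'k \<Rightarrow> nat \<Rightarrow> real) \<Rightarrow> ('j \<Rightarrow> 'k \<Rightarrow> nat \<Rightarrow> real) \<Rightarrow> bool" where
  "disaggregates P d p p0 v u \<longleftrightarrow> (\<forall>t\<le>horizon P.
     (\<forall>i\<in>nests_le P. \<forall>j\<in>nest P i.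
        (1 / dissim P i t - 1) * d j t * ln (p0 t / p i t) + d j t * ln (p0 t / d j t)
        = (\<Sum>k\<in>attrs P j t. u j k t)) \<and>
     (\<forall>i\<in>nests_le P. \<forall>k\<in>nest_attrs P i t.
        v i k t = (\<Sum>j\<in>products_with P i k t. u j k t)) \<and>
     (\<forall>j\<in>products_le P. \<forall>k\<in>lb_attrs P j t. u j k t \<ge> lb P j k t * d j t) \<and>
     (\<forall>j\<in>products_le P. \<forall>k\<in>ub_attrs P j t. u j k t \<le> ub P j k t * d j t))"

text \<open>For the problem of maximizing \<open>f\<close> over the feasible set \<open>F\<close>.\<close>

definition unbounded_problem :: "('a \<Rightarrow> real) \<Rightarrow> 'a set \<Rightarrow> bool" where
  "unbounded_problem f F \<longleftrightarrow> F \<noteq> {} \<and> \<not> bdd_above (f ` F)"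

definition optimal_solution :: "('a \<Rightarrow> real) \<Rightarrow> 'a set \<Rightarrow> 'a \<Rightarrow> bool" where
  "optimal_solution f F s \<longleftrightarrow> is_arg_max f (\<lambda>z. z \<in> F) s"

end

theory Submission
  imports Defs
begin

text \<open>
  The nested logit map from prices to choice probabilities can be inverted in closed form.  Since
  \<open>p\<^sub>i = p\<^sub>0 (W\<^sub>i powr \<gamma>\<^sub>i)\<close>, where \<open>W\<^sub>i\<close> is the weight of the nest, and
  \<open>d\<^sub>j = p\<^sub>i exp (- s\<^sub>j) / W\<^sub>i\<close>, where \<open>s\<^sub>j\<close> is the total attribute value of product \<open>j\<close>,
  eliminating \<open>W\<^sub>i\<close> gives
  \<open>s\<^sub>j = (1 / \<gamma>\<^sub>i - 1) ln (p\<^sub>0 / p\<^sub>i) + ln (p\<^sub>0 / d\<^sub>j)\<close>.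
  Conversely, any positive shares that sum to one and satisfy this identity are the nested logit
  probabilities (\<open>FP1_feasible_iff\<close>).  So the first problem asks for positive shares and attribute
  values whose totals equal these implied totals.

  The entropy and cap constraints of the second problem speak about the implied totals too
  (\<open>FP2_feasible_iff\<close>): in terms of the weighted values \<open>u\<^sub>j\<^sub>k = x\<^sub>j\<^sub>k d\<^sub>j\<close>, aggregated over the products of a nest in \<open>nests_le\<close>, it
  relaxes the equalities to inequalities.  Hence every feasible point of the first problem gives one
  of the second with the same objective value (\<open>FP1_embeds_in_FP2\<close>).

  The relaxation loses nothing.  As \<open>phi > 0\<close>, raising \<open>v\<close> and \<open>u\<close> improves the objective,
  and there is always room to raise them until the inequalities are tight (\<open>FP2_tightening\<close>):
  a product of a nest in \<open>nests_gt\<close> has an attribute without upper bound by the second condition,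
  and for a nest in \<open>nests_le\<close> either some coordinate of \<open>v\<close> has no upper bound, or every
  attribute is bounded above for every product of the nest; then all its products are capped, and
  the cap constraints, weighted by \<open>d\<^sub>j\<close> and added up, show that the caps leave enough room.  In
  particular an optimal solution is already tight.  At a tight point the first condition splits
  \<open>v\<close> into contributions of single products, and dividing by \<open>d\<^sub>j\<close> returns a feasible point of
  the first problem with the same objective value
  (\<open>tight_FP2_solution_yields_FP1_solution\<close>).  The three claims compare the two problems along
  these two maps.
\<close>

section \<open>Raising a vector to a prescribed total\<close>

text \<open>If some coordinate is free of an upper bound, it absorbs the whole deficit.  Otherwise the
  total is an affine function on the segment from \<open>v\<close> to \<open>h\<close> and takes the value \<open>c\<close> there.\<close>

lemma raise_to_total:
  fixes v h :: "'a \<Rightarrow> real"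
  assumes "finite K" "U \<subseteq> K"
    and le_h: "\<And>k. k \<in> U \<Longrightarrow> v k \<le> h k"
    and below: "sum v K \<le> c"
    and room: "U = K \<Longrightarrow> c \<le> sum h K"
  shows "\<exists>v'. (\<forall>k. v k \<le> v' k) \<and> (\<forall>k\<in>U. v' k \<le> h k) \<and> sum v' K = c"
proof (cases "U = K")
  case False
  then obtain k0 where k0: "k0 \<in> K" "k0 \<notin> U" using \<open>U \<subseteq> K\<close> by blast
  define v' where "v' = v(k0 := v k0 + (c - sum v K))"
  have "sum v' K = v' k0 + sum v' (K - {k0})" using k0 \<open>finite K\<close> by (simp add: sum.remove)
  also have "sum v' (K - {k0}) = sum v (K - {k0})" by (rule sum.cong) (auto simp: v'_def)
  also have "v' k0 + \<dots> = c" using k0 \<open>finite K\<close> by (simp add: v'_def sum.remove)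
  finally have "sum v' K = c" .
  moreover have "v k \<le> v' k" for k using below by (auto simp: v'_def)
  moreover have "v' k \<le> h k" if "k \<in> U" for k using that k0 le_h by (auto simp: v'_def)
  ultimately show ?thesis by blast
next
  case True
  show ?thesis
  proof (cases "sum v K = c")
    case True
    then show ?thesis using le_h by (intro exI[of _ v]) auto
  next
    case False
    with below room[OF \<open>U = K\<close>] have strict: "sum v K < c" "sum v K < sum h K" by auto
    define \<theta> where "\<theta> = (c - sum v K) / (sum h K - sum v K)"
    have \<theta>: "0 \<le> \<theta>" "\<theta> \<le> 1" using strict room[OF \<open>U = K\<close>] by (auto simp: \<theta>_def field_simps)
    define v' where "v' k = (if k \<in> K then v k + \<theta> * (h k - v k) else v k)" for k
    have "sum v' K = (\<Sum>k\<in>K. v k + \<theta> * (h k - v k))" by (simp add: v'_def)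
    also have "\<dots> = sum v K + \<theta> * (sum h K - sum v K)"
      by (simp add: sum.distrib sum_distrib_left[symmetric] sum_subtractf)
    also have "\<dots> = c" using strict by (simp add: \<theta>_def)
    finally have "sum v' K = c" .
    moreover have "v k \<le> v' k" for k
      using \<theta> le_h \<open>U = K\<close> by (auto simp: v'_def)
    moreover have "v' k \<le> h k" if "k \<in> U" for k
    proof -
      have "\<theta> * (h k - v k) \<le> 1 * (h k - v k)"
        using \<theta> le_h[OF that] by (intro mult_right_mono) auto
      then show ?thesis using that \<open>U = K\<close> by (simp add: v'_def)
    qed
    ultimately show ?thesis by blast
  qed
qed

section \<open>Nests and products\<close>

context nested_logit
begin

lemma nest_subset: "i \<in> nests P \<Longrightarrow> nest P i \<subseteq> products P"
  using nest_cover by blast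

lemma finite_nest: "i \<in> nests P \<Longrightarrow> finite (nest P i)"
  using nest_subset finite_products finite_subset by blast

lemma nests_le_subset: "nests_le P \<subseteq> nests P" and nests_gt_subset: "nests_gt P \<subseteq> nests P"
  by (auto simp: nests_le_def nests_gt_def)

lemma nests_le_gt_disjoint: "nests_le P \<inter> nests_gt P = {}"
  by (force simp: nests_le_def nests_gt_def)

lemma products_split: "products P = products_le P \<union> products_gt P"
  using nest_cover nest_types by (auto simp: products_le_def products_gt_def)

lemma products_le_gt_disjoint: "products_le P \<inter> products_gt P = {}"
  using nest_disjoint nests_le_gt_disjoint nests_le_subset nests_gt_subset
  unfolding products_le_def products_gt_def disjoint_family_on_def by fastforce

lemma products_le_subset: "products_le P \<subseteq> products P"
  and products_gt_subset: "products_gt P \<subseteq> products P"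
  using products_split by auto

lemma sum_products_le:
  fixes f :: "'j \<Rightarrow> real"
  shows "sum f (products_le P) = (\<Sum>i\<in>nests_le P. sum f (nest P i))"
  unfolding products_le_def
  using nest_disjoint nests_le_subset finite_nests finite_nest
  by (intro sum.UNION_disjoint)
     (auto simp: disjoint_family_on_def dest: subsetD intro: finite_subset)

lemma sum_products_split:
  fixes f :: "'j \<Rightarrow> real"
  shows "sum f (products P) = sum f (products_le P) + sum f (products_gt P)"
  using products_le_gt_disjoint finite_products products_split
  by (simp add: sum.union_disjoint)

lemma finite_nest_attrs: "\<lbrakk>i \<in> nests P; t \<le> horizon P\<rbrakk> \<Longrightarrow> finite (nest_attrs P i t)"
  unfolding nest_attrs_def using nest_subset by (intro finite_UN_I finite_nest finite_attrs) auto

lemma nest_ub_attrs_subset: "\<lbrakk>i \<in> nests P; t \<le> horizon P\<rbrakk> \<Longrightarrow> nest_ub_attrs P i t \<subseteq> nest_attrs P i t"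
proof
  fix k assume i: "i \<in> nests P" and t: "t \<le> horizon P" and k: "k \<in> nest_ub_attrs P i t"
  obtain j where "j \<in> nest P i" using nest_nonempty[OF i] by blast
  then show "k \<in> nest_attrs P i t"
    using k subsetD[OF nest_subset[OF i]] subsetD[OF ub_attrs_subset[OF _ t]]
    by (auto simp: nest_ub_attrs_def nest_attrs_def)
qed

lemma nest_attr_phi_pos:
  "\<lbrakk>i \<in> nests P; t \<le> horizon P; k \<in> nest_attrs P i t\<rbrakk> \<Longrightarrow> 0 < phi P k t"
  unfolding nest_attrs_def by (auto intro: phi_pos dest: subsetD[OF nest_subset])

section \<open>Inverting the choice probabilities\<close>

text \<open>The total attribute value of product \<open>j\<close> that the shares reveal: the inverse of the nested
  logit choice map.\<close>

definition implied_total ::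
  "('j \<Rightarrow> nat \<Rightarrow> real) \<Rightarrow> ('i \<Rightarrow> nat \<Rightarrow> real) \<Rightarrow> (nat \<Rightarrow> real) \<Rightarrow> 'i \<Rightarrow> 'j \<Rightarrow> nat \<Rightarrow> real" where
  "implied_total d p p0 i j t =
     (1 / dissim P i t - 1) * ln (p0 t / p i t) + ln (p0 t / d j t)"

definition interior_shares ::
  "('j \<Rightarrow> nat \<Rightarrow> real) \<Rightarrow> ('i \<Rightarrow> nat \<Rightarrow> real) \<Rightarrow> (nat \<Rightarrow> real) \<Rightarrow> nat \<Rightarrow> bool" where
  "interior_shares d p p0 t \<longleftrightarrow>
     p0 t + (\<Sum>i\<in>nests P. p i t) = 1 \<and> (\<forall>i\<in>nests P. p i t = (\<Sum>j\<in>nest P i. d j t)) \<and>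
     (\<forall>j\<in>products P. d j t > 0) \<and> p0 t > 0"

text \<open>The bounds are stated for the weighted values \<open>u j k t = x j k t * d j t\<close>, the form that both
  problems share; for \<open>d j t > 0\<close> they amount to the bounds on \<open>x\<close>.\<close>

definition within_bounds ::
  "'j set \<Rightarrow> ('j \<Rightarrow> nat \<Rightarrow> real) \<Rightarrow> ('j \<Rightarrow> 'k \<Rightarrow> nat \<Rightarrow> real) \<Rightarrow> nat \<Rightarrow> bool" where
  "within_bounds S d u t \<longleftrightarrow>
     (\<forall>j\<in>S. \<forall>k\<in>lb_attrs P j t. lb P j k t * d j t \<le> u j k t) \<and>
     (\<forall>j\<in>S. \<forall>k\<in>ub_attrs P j t. u j k t \<le> ub P j k t * d j t)"

lemma interior_sharesD:
  assumes "interior_shares d p p0 t"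
  shows "p0 t + (\<Sum>i\<in>nests P. p i t) = 1" "\<And>i. i \<in> nests P \<Longrightarrow> p i t = (\<Sum>j\<in>nest P i. d j t)"
    "\<And>j. j \<in> products P \<Longrightarrow> 0 < d j t" "0 < p0 t" "\<And>i. i \<in> nests P \<Longrightarrow> 0 < p i t"
proof -
  show "0 < p i t" if "i \<in> nests P" for i
    using assms that nest_subset[OF that] finite_nest[OF that] nest_nonempty[OF that]
    by (auto simp: interior_shares_def intro!: sum_pos)
qed (use assms in \<open>auto simp: interior_shares_def\<close>)

text \<open>The no-purchase share is the reciprocal of the common denominator, so
  \<open>ln p\<^sub>i = \<gamma>\<^sub>i ln W\<^sub>i + ln p\<^sub>0\<close> and \<open>ln d\<^sub>j = ln p\<^sub>i - s\<^sub>j - ln W\<^sub>i\<close>; substituting both makes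
  \<open>ln W\<^sub>i\<close> cancel.\<close>

lemma choice_probabilities_imp_implied_total:
  assumes t: "t \<le> horizon P"
    and d: "\<And>i j. i \<in> nests P \<Longrightarrow> j \<in> nest P i \<Longrightarrow>
        d j t = p i t * (exp (- (\<Sum>k\<in>attrs P j t. x j k t)) / nest_weight P x i t)"
    and p: "\<And>i. i \<in> nests P \<Longrightarrow> p i t = nest_weight P x i t powr dissim P i t /
          (1 + (\<Sum>i'\<in>nests P. nest_weight P x i' t powr dissim P i' t))"
    and p0: "p0 t = 1 / (1 + (\<Sum>i\<in>nests P. nest_weight P x i t powr dissim P i t))"
  shows "interior_shares d p p0 t"
    and "\<And>i j. i \<in> nests P \<Longrightarrow> j \<in> nest P i \<Longrightarrow>
        implied_total d p p0 i j t = (\<Sum>k\<in>attrs P j t. x j k t)"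
proof -
  let ?D = "1 + (\<Sum>i\<in>nests P. nest_weight P x i t powr dissim P i t)"
  have D: "?D > 0" by (simp add: add_pos_nonneg sum_nonneg)
  have W: "nest_weight P x i t > 0" if "i \<in> nests P" for i
    unfolding nest_weight_def using that nest_nonempty finite_nest by (auto intro!: sum_pos)
  have p_pos: "p i t > 0" if "i \<in> nests P" for i
    using p[OF that] W[OF that] D by simp
  have d_pos: "d j t > 0" if "i \<in> nests P" "j \<in> nest P i" for i j
    using d[OF that] p_pos[OF that(1)] W[OF that(1)] by simp
  have p0_pos: "p0 t > 0" using p0 D by simp
  have "(\<Sum>i\<in>nests P. p i t) = (?D - 1) / ?D"
    by (simp add: p sum_divide_distrib)
  then have "p0 t + (\<Sum>i\<in>nests P. p i t) = 1"
    using p0 D by (simp add: add_divide_distrib[symmetric])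
  moreover have "p i t = (\<Sum>j\<in>nest P i. d j t)" if i: "i \<in> nests P" for i
  proof -
    have "(\<Sum>j\<in>nest P i. d j t)
        = (\<Sum>j\<in>nest P i. p i t * (exp (- (\<Sum>k\<in>attrs P j t. x j k t)) / nest_weight P x i t))"
      using d i by simp
    also have "\<dots> = p i t * (nest_weight P x i t / nest_weight P x i t)"
      by (simp only: sum_distrib_left[symmetric] sum_divide_distrib[symmetric]
          nest_weight_def[symmetric])
    finally show ?thesis using W[OF i] by simp
  qed
  ultimately show "interior_shares d p p0 t"
    using d_pos p0_pos unfolding interior_shares_def nest_cover[symmetric] by blast
  fix i j assume ij: "i \<in> nests P" "j \<in> nest P i"
  define S where "S = (\<Sum>k\<in>attrs P j t. x j k t)"
  define L where "L = ln (nest_weight P x i t)"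
  have ln_p: "ln (p i t) = dissim P i t * L + ln (p0 t)"
    using p[OF ij(1)] W[OF ij(1)] D p0 by (simp add: ln_div ln_powr L_def)
  have ln_d: "ln (d j t) = ln (p i t) - S - L"
    using d[OF ij] p_pos[OF ij(1)] W[OF ij(1)] by (simp add: ln_div ln_mult L_def S_def)
  have "implied_total d p p0 i j t
      = (1 / dissim P i t - 1) * (ln (p0 t) - ln (p i t)) + (ln (p0 t) - ln (d j t))"
    using p_pos[OF ij(1)] d_pos[OF ij] p0_pos by (simp add: implied_total_def ln_div)
  also have "\<dots> = S"
    unfolding ln_d ln_p using dissim_pos[OF ij(1) t] by (simp add: field_simps)
  finally show "implied_total d p p0 i j t = (\<Sum>k\<in>attrs P j t. x j k t)"
    by (simp add: S_def)
qed

text \<open>The identity determines each \<open>exp (- s\<^sub>j)\<close> as \<open>d\<^sub>j\<close> times a factor \<open>c\<^sub>i\<close> that depends only on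
  the nest.  Summing over the nest gives \<open>W\<^sub>i = p\<^sub>i c\<^sub>i\<close>, which is the \<open>\<gamma>\<^sub>i\<close>-th root of
  \<open>p\<^sub>i / p\<^sub>0\<close>, and since the shares sum to one the denominator is \<open>1 / p\<^sub>0\<close>.\<close>

lemma implied_total_imp_choice_probabilities:
  assumes t: "t \<le> horizon P" and shares: "interior_shares d p p0 t"
    and x: "\<And>i j. i \<in> nests P \<Longrightarrow> j \<in> nest P i \<Longrightarrow>
        (\<Sum>k\<in>attrs P j t. x j k t) = implied_total d p p0 i j t"
    and i: "i \<in> nests P"
  shows "j \<in> nest P i \<Longrightarrow>
        d j t = p i t * (exp (- (\<Sum>k\<in>attrs P j t. x j k t)) / nest_weight P x i t)"
    and "p i t = nest_weight P x i t powr dissim P i t /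
          (1 + (\<Sum>i'\<in>nests P. nest_weight P x i' t powr dissim P i' t))"
proof -
  note sh = interior_sharesD[OF shares]
  define c where "c i = exp ((1 / dissim P i t - 1) * ln (p i t / p0 t)) / p0 t" for i
  have attraction: "exp (- (\<Sum>k\<in>attrs P j t. x j k t)) = d j t * c i"
    if "i \<in> nests P" "j \<in> nest P i" for i j
  proof -
    have dj: "0 < d j t" using that nest_subset sh(3) by blast
    have "- implied_total d p p0 i j t
        = ln (d j t) + (1 / dissim P i t - 1) * ln (p i t / p0 t) - ln (p0 t)"
      using dj sh(4) sh(5)[OF that(1)] by (simp add: implied_total_def ln_div algebra_simps)
    then show ?thesis using dj sh(4) x[OF that] by (simp add: exp_diff exp_add c_def)
  qed
  have weight: "nest_weight P x i t = p i t * c i" if "i \<in> nests P" for i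
    unfolding nest_weight_def using that sh(2)
    by (simp add: attraction sum_distrib_right)
  have c_pos: "c i > 0" for i using sh(4) by (simp add: c_def)
  have power: "nest_weight P x i t powr dissim P i t = p i t / p0 t" if i: "i \<in> nests P" for i
  proof -
    define g where "g = dissim P i t"
    have g: "g > 0" using dissim_pos[OF i t] by (simp add: g_def)
    have W: "nest_weight P x i t > 0" using weight[OF i] c_pos sh(5)[OF i] by simp
    have "ln (nest_weight P x i t) = ln (p i t / p0 t) / g"
      using weight[OF i] c_pos[of i] sh(4) sh(5)[OF i]
      by (simp add: ln_mult ln_div c_def g_def[symmetric] algebra_simps diff_divide_distrib)
    then have "g * ln (nest_weight P x i t) = ln (p i t / p0 t)" using g by simp
    then show ?thesis using W sh(4) sh(5)[OF i] by (simp add: powr_def g_def)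
  qed
  show "d j t = p i t * (exp (- (\<Sum>k\<in>attrs P j t. x j k t)) / nest_weight P x i t)"
    if "j \<in> nest P i"
    using attraction[OF i that] weight[OF i] c_pos[of i] sh(5)[OF i] by simp
  have "1 + (\<Sum>i'\<in>nests P. nest_weight P x i' t powr dissim P i' t)
      = (p0 t + (\<Sum>i'\<in>nests P. p i' t)) / p0 t"
    using sh(4) by (simp add: power add_divide_distrib sum_divide_distrib)
  then show "p i t = nest_weight P x i t powr dissim P i t /
          (1 + (\<Sum>i'\<in>nests P. nest_weight P x i' t powr dissim P i' t))"
    using sh(1,4) power[OF i] by simp
qed

lemma FP1_feasible_iff:
  "(d, p, x) \<in> FP1_feasible P \<longleftrightarrow> (\<exists>p0. resource_feasible P d \<and> (\<forall>t\<le>horizon P.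
     interior_shares d p p0 t \<and>
     (\<forall>i\<in>nests P. \<forall>j\<in>nest P i. (\<Sum>k\<in>attrs P j t. x j k t) = implied_total d p p0 i j t) \<and>
     within_bounds (products P) d (\<lambda>j k t. x j k t * d j t) t))" (is "_ \<longleftrightarrow> ?R")
proof
  assume feas: "(d, p, x) \<in> FP1_feasible P"
  define p0 where
    "p0 t = 1 / (1 + (\<Sum>i\<in>nests P. nest_weight P x i t powr dissim P i t))" for t
  have *: "interior_shares d p p0 t \<and>
     (\<forall>i\<in>nests P. \<forall>j\<in>nest P i. implied_total d p p0 i j t = (\<Sum>k\<in>attrs P j t. x j k t))"
    if t: "t \<le> horizon P" for t
    using choice_probabilities_imp_implied_total[OF t, of d p x p0] feas t
    unfolding FP1_feasible_def p0_def by auto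
  have "within_bounds (products P) d (\<lambda>j k t. x j k t * d j t) t" if t: "t \<le> horizon P" for t
    using feas t * interior_sharesD(3)[of d p p0 t]
    unfolding within_bounds_def FP1_feasible_def by (auto intro!: mult_right_mono less_imp_le)
  with * feas show ?R by (intro exI[of _ p0]) (auto simp: FP1_feasible_def)
next
  assume ?R
  then obtain p0 where R: "resource_feasible P d"
    "\<And>t. t \<le> horizon P \<Longrightarrow> interior_shares d p p0 t"
    "\<And>t i j. t \<le> horizon P \<Longrightarrow> i \<in> nests P \<Longrightarrow> j \<in> nest P i \<Longrightarrow>
       (\<Sum>k\<in>attrs P j t. x j k t) = implied_total d p p0 i j t"
    "\<And>t. t \<le> horizon P \<Longrightarrow> within_bounds (products P) d (\<lambda>j k t. x j k t * d j t) t"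
    by blast
  have d: "0 < d j t" if "t \<le> horizon P" "j \<in> products P" for j t
    using interior_sharesD(3)[OF R(2)[OF that(1)] that(2)] .
  have "d j t = p i t * (exp (- (\<Sum>k\<in>attrs P j t. x j k t)) / nest_weight P x i t)"
    if "t \<le> horizon P" "i \<in> nests P" "j \<in> nest P i" for t i j
    by (rule implied_total_imp_choice_probabilities(1)[where ?p0.0 = p0])
      (simp_all add: that R(2) R(3))
  moreover have "p i t = nest_weight P x i t powr dissim P i t /
          (1 + (\<Sum>i'\<in>nests P. nest_weight P x i' t powr dissim P i' t))"
    if "t \<le> horizon P" "i \<in> nests P" for t i
    by (rule implied_total_imp_choice_probabilities(2)[where ?p0.0 = p0 and ?d = d])
      (simp_all add: that R(2) R(3))
  moreover have "lb P j k t \<le> x j k t"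
    if "t \<le> horizon P" "j \<in> products P" "k \<in> lb_attrs P j t" for t j k
    using R(4)[OF that(1)] d that by (auto simp: within_bounds_def)
  moreover have "x j k t \<le> ub P j k t"
    if "t \<le> horizon P" "j \<in> products P" "k \<in> ub_attrs P j t" for t j k
    using R(4)[OF that(1)] d that by (auto simp: within_bounds_def)
  ultimately show "(d, p, x) \<in> FP1_feasible P"
    using R(1) by (auto simp: FP1_feasible_def)
qed

section \<open>The convex program in terms of implied totals\<close>

text \<open>The entropy terms of the second problem are implied totals weighted by \<open>d\<close>: for a nest by
  summation, for a product by splitting \<open>ln (p\<^sub>i / d\<^sub>j)\<close> as a difference of logarithms.\<close>

lemma nest_entropy_eq:
  assumes "interior_shares d p p0 t" "i \<in> nests P"
  shows "(1 / dissim P i t - 1) * p i t * ln (p0 t / p i t) + (\<Sum>j\<in>nest P i. d j t * ln (p0 t / d j t))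
    = (\<Sum>j\<in>nest P i. d j t * implied_total d p p0 i j t)"
proof -
  have "(\<Sum>j\<in>nest P i. d j t * implied_total d p p0 i j t)
      = (1 / dissim P i t - 1) * (\<Sum>j\<in>nest P i. d j t) * ln (p0 t / p i t)
        + (\<Sum>j\<in>nest P i. d j t * ln (p0 t / d j t))"
    unfolding implied_total_def sum_distrib_left sum_distrib_right sum.distrib[symmetric]
    by (simp add: algebra_simps)
  then show ?thesis using interior_sharesD(2)[OF assms] by simp
qed

lemma product_entropy_eq:
  assumes "interior_shares d p p0 t" "i \<in> nests P" "j \<in> nest P i"
  shows "(1 - 1 / dissim P i t) * d j t * ln (p i t / d j t) + 1 / dissim P i t * d j t * ln (p0 t / d j t)
    = d j t * implied_total d p p0 i j t"
proof -
  have "0 < d j t" "0 < p0 t" "0 < p i t"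
    using interior_sharesD[OF assms(1)] assms nest_subset by blast+
  then show ?thesis by (simp add: implied_total_def ln_div algebra_simps diff_divide_distrib)
qed

lemma FP2_feasible_iff:
  "(d, p, p0, v, u) \<in> FP2_feasible P \<longleftrightarrow> resource_feasible P d \<and> (\<forall>t\<le>horizon P.
     interior_shares d p p0 t \<and>
     (\<forall>i\<in>nests_le P. (\<Sum>k\<in>nest_attrs P i t. v i k t)
        \<le> (\<Sum>j\<in>nest P i. d j t * implied_total d p p0 i j t)) \<and>
     (\<forall>i\<in>nests_le P. \<forall>j\<in>capped_products P i t.
        implied_total d p p0 i j t \<le> (\<Sum>k\<in>attrs P j t. ub P j k t)) \<and>
     (\<forall>i\<in>nests_gt P. \<forall>j\<in>nest P i.
        (\<Sum>k\<in>attrs P j t. u j k t) \<le> d j t * implied_total d p p0 i j t) \<and>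
     (\<forall>i\<in>nests_le P. \<forall>k\<in>nest_lb_attrs P i t. (\<Sum>j\<in>nest P i. lb P j k t * d j t) \<le> v i k t) \<and>
     (\<forall>i\<in>nests_le P. \<forall>k\<in>nest_ub_attrs P i t. v i k t \<le> (\<Sum>j\<in>nest P i. ub P j k t * d j t)) \<and>
     within_bounds (products_gt P) d u t)"
proof -
  have cap: "((1 / dissim P i t - 1) * p0 t * ln (p0 t / p i t) + p0 t * ln (p0 t / d j t)
          \<le> p0 t * b) = (implied_total d p p0 i j t \<le> b)"
    if "interior_shares d p p0 t" for i j t b
  proof -
    have "(1 / dissim P i t - 1) * p0 t * ln (p0 t / p i t) + p0 t * ln (p0 t / d j t)
      = p0 t * implied_total d p p0 i j t" by (simp add: implied_total_def algebra_simps)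
    then show ?thesis using interior_sharesD(4)[OF that] by simp
  qed
  have *: "(\<forall>i\<in>nests_le P.
          (1 / dissim P i t - 1) * p i t * ln (p0 t / p i t)
            + (\<Sum>j\<in>nest P i. d j t * ln (p0 t / d j t))
          \<ge> (\<Sum>k\<in>nest_attrs P i t. v i k t)) \<longleftrightarrow> (\<forall>i\<in>nests_le P. (\<Sum>k\<in>nest_attrs P i t. v i k t)
        \<le> (\<Sum>j\<in>nest P i. d j t * implied_total d p p0 i j t))"
     "(\<forall>i\<in>nests_gt P. \<forall>j\<in>nest P i.
          (1 - 1 / dissim P i t) * d j t * ln (p i t / d j t)
            + 1 / dissim P i t * d j t * ln (p0 t / d j t)
          \<ge> (\<Sum>k\<in>attrs P j t. u j k t)) \<longleftrightarrow> (\<forall>i\<in>nests_gt P. \<forall>j\<in>nest P i.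
        (\<Sum>k\<in>attrs P j t. u j k t) \<le> d j t * implied_total d p p0 i j t)"
     if "interior_shares d p p0 t" for t
    using nests_le_subset nests_gt_subset nest_entropy_eq[OF that] product_entropy_eq[OF that]
    by (auto simp: subset_iff)
  show ?thesis
    unfolding FP2_feasible_def mem_Collect_eq prod.case
  proof (rule arg_cong2[where f = conj, OF refl], rule all_cong1, rule imp_cong[OF refl], goal_cases)
    case (1 t)
    \<comment> \<open>The conjuncts \<open>A\<close> to \<open>D\<close> are those of \<open>interior_shares\<close>; the constraints on totals may be
      rewritten only where the shares are known to be positive.\<close>
    have regroup: "(X1 \<and> X2 \<and> X3 \<and> A \<and> B \<and> C \<and> D \<and> Z) = ((A \<and> B \<and> C \<and> D) \<and> Y1 \<and> Y2 \<and> Y3 \<and> Z)"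
      if "A \<and> B \<and> C \<and> D \<Longrightarrow> X1 = Y1" "A \<and> B \<and> C \<and> D \<Longrightarrow> X2 = Y2" "A \<and> B \<and> C \<and> D \<Longrightarrow> X3 = Y3"
      for A B C D X1 X2 X3 Y1 Y2 Y3 Z using that by blast
    show ?case
      unfolding interior_shares_def within_bounds_def
      by (rule regroup; fold interior_shares_def) (simp_all only: * cap)
  qed
qed

lemma FP2_tight_iff:
  assumes "\<And>t. t \<le> horizon P \<Longrightarrow> interior_shares d p p0 t"
  shows "FP2_tight P d p p0 v \<longleftrightarrow> (\<forall>t\<le>horizon P. \<forall>i\<in>nests_le P.
     (\<Sum>k\<in>nest_attrs P i t. v i k t) = (\<Sum>j\<in>nest P i. d j t * implied_total d p p0 i j t))"
proof -
  have "((1 / dissim P i t - 1) * p i t * ln (p0 t / p i t)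
       + (\<Sum>j\<in>nest P i. d j t * ln (p0 t / d j t)) = (\<Sum>k\<in>nest_attrs P i t. v i k t))
     = ((\<Sum>k\<in>nest_attrs P i t. v i k t) = (\<Sum>j\<in>nest P i. d j t * implied_total d p p0 i j t))"
    if "t \<le> horizon P" "i \<in> nests_le P" for t i
    unfolding nest_entropy_eq[OF assms[OF that(1)] subsetD[OF nests_le_subset that(2)]]
    by (rule eq_commute)
  then show ?thesis by (simp add: FP2_tight_def)
qed

lemma disaggregates_iff:
  "disaggregates P d p p0 v u \<longleftrightarrow> (\<forall>t\<le>horizon P.
     (\<forall>i\<in>nests_le P. \<forall>j\<in>nest P i. (\<Sum>k\<in>attrs P j t. u j k t) = d j t * implied_total d p p0 i j t) \<and>
     (\<forall>i\<in>nests_le P. \<forall>k\<in>nest_attrs P i t. v i k t = (\<Sum>j\<in>products_with P i k t. u j k t)) \<and>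
     within_bounds (products_le P) d u t)"
proof -
  have "(1 / dissim P i t - 1) * d j t * ln (p0 t / p i t) + d j t * ln (p0 t / d j t)
     = d j t * implied_total d p p0 i j t" for i j t
    by (simp add: implied_total_def algebra_simps)
  then show ?thesis unfolding disaggregates_def within_bounds_def by (auto 0 0)
qed

section \<open>Translating solutions between the problems\<close>

lemma sum_nest_attrs_swap:
  fixes u :: "'j \<Rightarrow> 'k \<Rightarrow> real"
  assumes "i \<in> nests P" "t \<le> horizon P"
  shows "(\<Sum>k\<in>nest_attrs P i t. \<Sum>j\<in>products_with P i k t. u j k)
    = (\<Sum>j\<in>nest P i. \<Sum>k\<in>attrs P j t. u j k)"
proof -
  have "{k \<in> nest_attrs P i t. k \<in> attrs P j t} = attrs P j t" if "j \<in> nest P i" for j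
    using that by (auto simp: nest_attrs_def)
  then show ?thesis
    using sum.swap_restrict[of "nest_attrs P i t" "nest P i" "\<lambda>k j. u j k" "\<lambda>k j. k \<in> attrs P j t"]
      finite_nest_attrs[OF assms] finite_nest[OF assms(1)]
    by (simp add: products_with_def)
qed

lemma FP_objectives_eq:
  assumes v: "\<And>t i k. t \<le> horizon P \<Longrightarrow> i \<in> nests_le P \<Longrightarrow> k \<in> nest_attrs P i t \<Longrightarrow>
      v i k t = (\<Sum>j\<in>products_with P i k t. x j k t * d j t)"
    and u: "\<And>t j k. t \<le> horizon P \<Longrightarrow> j \<in> products_gt P \<Longrightarrow> k \<in> attrs P j t \<Longrightarrow>
      u j k t = x j k t * d j t"
  shows "FP2_objective P (d, p, p0, v, u) = FP1_objective P (d, p, x)"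
proof -
  have "(\<Sum>j\<in>products P. ((\<Sum>k\<in>attrs P j t. phi P k t * x j k t) - psi P j t) * d j t)
    = (\<Sum>i\<in>nests_le P. \<Sum>k\<in>nest_attrs P i t. phi P k t * v i k t)
    + (\<Sum>j\<in>products_gt P. \<Sum>k\<in>attrs P j t. phi P k t * u j k t)
    - (\<Sum>j\<in>products P. psi P j t * d j t)" if t: "t \<le> horizon P" for t
  proof -
    let ?r = "\<lambda>j. \<Sum>k\<in>attrs P j t. phi P k t * (x j k t * d j t)"
    have "(\<Sum>k\<in>nest_attrs P i t. phi P k t * v i k t) = sum ?r (nest P i)" if i: "i \<in> nests_le P" for i
      using sum_nest_attrs_swap[of i t "\<lambda>j k. phi P k t * (x j k t * d j t)"] i t nests_le_subset v
      by (auto simp: sum_distrib_left)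
    then have "(\<Sum>i\<in>nests_le P. \<Sum>k\<in>nest_attrs P i t. phi P k t * v i k t) = sum ?r (products_le P)"
      by (simp add: sum_products_le)
    moreover have "(\<Sum>j\<in>products_gt P. \<Sum>k\<in>attrs P j t. phi P k t * u j k t) = sum ?r (products_gt P)"
      using u t by simp
    moreover have "(\<Sum>j\<in>products P. ((\<Sum>k\<in>attrs P j t. phi P k t * x j k t) - psi P j t) * d j t)
      = sum ?r (products P) - (\<Sum>j\<in>products P. psi P j t * d j t)"
      by (simp add: left_diff_distrib sum_subtractf sum_distrib_right mult.assoc)
    ultimately show ?thesis by (simp add: sum_products_split)
  qed
  then show ?thesis
    by (simp add: FP1_objective_def FP2_objective_def distrib_left right_diff_distrib
        sum.distrib sum_subtractf)
qed

text \<open>With \<open>u j k t = x j k t * d j t\<close> and \<open>v\<close> its aggregate, the entropy constraints hold with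
  equality.  A bound on \<open>v i k t\<close> is imposed only when every product of the nest has attribute
  \<open>k\<close> and a bound for it, so it is a sum of bounds on single products.\<close>

lemma FP1_embeds_in_FP2:
  assumes "(d, p, x) \<in> FP1_feasible P"
  obtains p0 v u where "(d, p, p0, v, u) \<in> FP2_feasible P"
    "FP2_objective P (d, p, p0, v, u) = FP1_objective P (d, p, x)"
proof -
  obtain p0 where R: "resource_feasible P d"
    "\<And>t. t \<le> horizon P \<Longrightarrow> interior_shares d p p0 t"
    "\<And>t i j. t \<le> horizon P \<Longrightarrow> i \<in> nests P \<Longrightarrow> j \<in> nest P i \<Longrightarrow>
       (\<Sum>k\<in>attrs P j t. x j k t) = implied_total d p p0 i j t"
    "\<And>t. t \<le> horizon P \<Longrightarrow> within_bounds (products P) d (\<lambda>j k t. x j k t * d j t) t"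
    using assms unfolding FP1_feasible_iff by blast
  define u where "u j k t = x j k t * d j t" for j k t
  define v where "v i k t = (\<Sum>j\<in>products_with P i k t. u j k t)" for i k t
  have bnd: "lb P j k t * d j t \<le> u j k t" if "t \<le> horizon P" "j \<in> products P" "k \<in> lb_attrs P j t" for j k t
    using R(4)[OF that(1)] that by (auto simp: within_bounds_def u_def)
  have bnd': "u j k t \<le> ub P j k t * d j t" if "t \<le> horizon P" "j \<in> products P" "k \<in> ub_attrs P j t" for j k t
    using R(4)[OF that(1)] that by (auto simp: within_bounds_def u_def)
  have total: "(\<Sum>k\<in>attrs P j t. u j k t) = d j t * implied_total d p p0 i j t"
    if "t \<le> horizon P" "i \<in> nests P" "j \<in> nest P i" for i j t
    using R(3)[OF that] by (simp add: u_def sum_distrib_right[symmetric])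
  \<comment> \<open>An attribute bounded for every product of the nest belongs to every product of the nest.\<close>
  have common_lb: "products_with P i k t = nest P i"
    if "t \<le> horizon P" "i \<in> nests P" "k \<in> nest_lb_attrs P i t" for i k t
    using that lb_attrs_subset nest_subset by (fastforce simp: products_with_def nest_lb_attrs_def)
  have common_ub: "products_with P i k t = nest P i"
    if "t \<le> horizon P" "i \<in> nests P" "k \<in> nest_ub_attrs P i t" for i k t
    using that ub_attrs_subset nest_subset by (fastforce simp: products_with_def nest_ub_attrs_def)
  have "(d, p, p0, v, u) \<in> FP2_feasible P"
    unfolding FP2_feasible_iff
  proof (intro conjI allI impI ballI, goal_cases)
    case 1 then show ?case by (rule R)
  next
    case 2 then show ?case by (rule R)
  next
    case (3 t i)
    then have "i \<in> nests P" using nests_le_subset by blast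
    then show ?case using sum_nest_attrs_swap[of i t "\<lambda>j k. u j k t"] total 3 by (simp add: v_def)
  next
    case (4 t i j)
    then have ij: "i \<in> nests P" "j \<in> nest P i" "j \<in> products P" "ub_attrs P j t = attrs P j t"
      using nests_le_subset nest_subset by (auto simp: capped_products_def)
    have "(\<Sum>k\<in>attrs P j t. u j k t) \<le> (\<Sum>k\<in>attrs P j t. ub P j k t * d j t)"
      using bnd' 4 ij by (intro sum_mono) auto
    then have "d j t * implied_total d p p0 i j t \<le> d j t * (\<Sum>k\<in>attrs P j t. ub P j k t)"
      using total ij 4 by (simp add: sum_distrib_left mult.commute)
    then show ?case using interior_sharesD(3)[OF R(2) ij(3)] 4 by simp
  next
    case (5 t i j)
    then show ?case using total nests_gt_subset by force
  next
    case (6 t i k)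
    then have "i \<in> nests P" using nests_le_subset by blast
    then show ?case unfolding v_def common_lb[OF 6(1) \<open>i \<in> nests P\<close> 6(3)]
      using bnd[OF 6(1)] 6(3) subsetD[OF nest_subset[OF \<open>i \<in> nests P\<close>]]
      by (intro sum_mono) (auto simp: nest_lb_attrs_def)
  next
    case (7 t i k)
    then have "i \<in> nests P" using nests_le_subset by blast
    then show ?case unfolding v_def common_ub[OF 7(1) \<open>i \<in> nests P\<close> 7(3)]
      using bnd'[OF 7(1)] 7(3) subsetD[OF nest_subset[OF \<open>i \<in> nests P\<close>]]
      by (intro sum_mono) (auto simp: nest_ub_attrs_def)
  next
    case (8 t)
    then show ?case using bnd bnd' products_gt_subset by (auto simp: within_bounds_def)
  qed
  moreover have "FP2_objective P (d, p, p0, v, u) = FP1_objective P (d, p, x)"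
    by (rule FP_objectives_eq) (simp_all add: v_def u_def)
  ultimately show ?thesis using that by blast
qed

text \<open>The counterpart of \<open>FP2_tight\<close> for the nests with large dissimilarity, whose variables are
  not aggregated.\<close>

definition gt_tight ::
  "('j \<Rightarrow> nat \<Rightarrow> real) \<Rightarrow> ('i \<Rightarrow> nat \<Rightarrow> real) \<Rightarrow> (nat \<Rightarrow> real) \<Rightarrow> ('j \<Rightarrow> 'k \<Rightarrow> nat \<Rightarrow> real) \<Rightarrow> bool" where
  "gt_tight d p p0 u \<longleftrightarrow> (\<forall>t\<le>horizon P. \<forall>i\<in>nests_gt P. \<forall>j\<in>nest P i.
     (\<Sum>k\<in>attrs P j t. u j k t) = d j t * implied_total d p p0 i j t)"

text \<open>At a tight point the totals of \<open>x = u / d\<close> are the implied totals, on \<open>nests_le\<close> by the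
  disaggregated system and on \<open>nests_gt\<close> by tightness, so the inverted choice map applies.\<close>

lemma tight_FP2_solution_yields_FP1_solution:
  assumes feas: "(d, p, p0, v, u) \<in> FP2_feasible P" and gt: "gt_tight d p p0 u"
    and dis: "disaggregates P d p p0 v u_le"
    and x_le: "\<And>t j k. t \<le> horizon P \<Longrightarrow> j \<in> products_le P \<Longrightarrow> k \<in> attrs P j t \<Longrightarrow>
      x j k t = u_le j k t / d j t"
    and x_gt: "\<And>t j k. t \<le> horizon P \<Longrightarrow> j \<in> products_gt P \<Longrightarrow> k \<in> attrs P j t \<Longrightarrow>
      x j k t = u j k t / d j t"
  shows "(d, p, x) \<in> FP1_feasible P"
    and "FP1_objective P (d, p, x) = FP2_objective P (d, p, p0, v, u)"
proof -
  have shares: "interior_shares d p p0 t" if "t \<le> horizon P" for t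
    using feas that by (simp add: FP2_feasible_iff)
  have d: "0 < d j t" if "t \<le> horizon P" "j \<in> products P" for j t
    using interior_sharesD(3)[OF shares] that .
  have le: "x j k t * d j t = u_le j k t"
    if "t \<le> horizon P" "j \<in> products_le P" "k \<in> attrs P j t" for t j k
    using x_le[OF that] d[of t j] that products_le_subset by fastforce
  have gt': "x j k t * d j t = u j k t"
    if "t \<le> horizon P" "j \<in> products_gt P" "k \<in> attrs P j t" for t j k
    using x_gt[OF that] d[of t j] that products_gt_subset by fastforce
  have "(\<Sum>k\<in>attrs P j t. x j k t) * d j t = d j t * implied_total d p p0 i j t"
    if tij: "t \<le> horizon P" "i \<in> nests P" "j \<in> nest P i" for t i j
  proof (cases "i \<in> nests_le P")
    case True
    then have "j \<in> products_le P" using tij by (auto simp: products_le_def)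
    then show ?thesis using dis tij True le by (simp add: disaggregates_iff sum_distrib_right)
  next
    case False
    then have i: "i \<in> nests_gt P" using nest_types tij by auto
    then have "j \<in> products_gt P" using tij by (auto simp: products_gt_def)
    then show ?thesis using gt tij i gt' by (simp add: gt_tight_def sum_distrib_right)
  qed
  then have "(\<Sum>k\<in>attrs P j t. x j k t) = implied_total d p p0 i j t"
    if "t \<le> horizon P" "i \<in> nests P" "j \<in> nest P i" for t i j
    using that d[of t j] nest_subset by fastforce
  moreover have "within_bounds (products P) d (\<lambda>j k t. x j k t * d j t) t" if t: "t \<le> horizon P" for t
  proof -
    have "within_bounds (products_le P) d u_le t" "within_bounds (products_gt P) d u t"
      using dis feas t by (auto simp: disaggregates_iff FP2_feasible_iff)
    moreover have "x j k t * d j t = (if j \<in> products_le P then u_le j k t else u j k t)"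
      if "j \<in> products P" "k \<in> attrs P j t" for j k
      using that le[OF t] gt'[OF t] products_split by auto
    ultimately show ?thesis
      using products_split subsetD[OF lb_attrs_subset[OF _ t]] subsetD[OF ub_attrs_subset[OF _ t]]
      by (auto simp: within_bounds_def)
  qed
  ultimately show "(d, p, x) \<in> FP1_feasible P"
    using feas shares unfolding FP1_feasible_iff FP2_feasible_iff by blast
  have "v i k t = (\<Sum>j\<in>products_with P i k t. x j k t * d j t)"
    if "t \<le> horizon P" "i \<in> nests_le P" "k \<in> nest_attrs P i t" for t i k
  proof -
    have "x j k t * d j t = u_le j k t" if "j \<in> products_with P i k t" for j
      using that le[of t j k] \<open>t \<le> horizon P\<close> \<open>i \<in> nests_le P\<close>
      by (auto simp: products_with_def products_le_def)
    then show ?thesis using dis that by (simp add: disaggregates_iff)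
  qed
  then show "FP1_objective P (d, p, x) = FP2_objective P (d, p, p0, v, u)"
    using gt' by (intro FP_objectives_eq[symmetric]) auto
qed

section \<open>Tightening the convex program\<close>

text \<open>When every attribute of the nest is bounded above for every product, all products of the nest
  have the same attributes and all are capped.  The cap constraints bound the implied totals; their
  sum with weights \<open>d\<^sub>j\<close> is the claim.  This is the step for which the second problem contains
  the cap constraints.\<close>

lemma FP2_nest_slack_fits_below_caps:
  assumes feas: "(d, p, p0, v, u) \<in> FP2_feasible P" and t: "t \<le> horizon P" and i: "i \<in> nests_le P"
    and all: "nest_ub_attrs P i t = nest_attrs P i t"
  shows "(\<Sum>j\<in>nest P i. d j t * implied_total d p p0 i j t)
    \<le> (\<Sum>k\<in>nest_attrs P i t. \<Sum>j\<in>nest P i. ub P j k t * d j t)"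
proof -
  have iP: "i \<in> nests P" using i nests_le_subset by blast
  have same: "attrs P j t = nest_attrs P i t \<and> j \<in> capped_products P i t" if "j \<in> nest P i" for j
    using that all ub_attrs_subset[of j t] nest_subset[OF iP] t
    by (auto simp: capped_products_def nest_attrs_def nest_ub_attrs_def)
  have cap: "\<forall>j\<in>capped_products P i t. implied_total d p p0 i j t \<le> (\<Sum>k\<in>attrs P j t. ub P j k t)"
    and shares: "interior_shares d p p0 t"
    using feas t i by (simp_all add: FP2_feasible_iff)
  have "(\<Sum>j\<in>nest P i. d j t * implied_total d p p0 i j t)
      \<le> (\<Sum>j\<in>nest P i. d j t * (\<Sum>k\<in>attrs P j t. ub P j k t))"
  proof (intro sum_mono mult_left_mono)
    fix j assume j: "j \<in> nest P i"
    show "implied_total d p p0 i j t \<le> (\<Sum>k\<in>attrs P j t. ub P j k t)"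
      using cap same[OF j] by blast
    show "0 \<le> d j t"
      using interior_sharesD(3)[OF shares subsetD[OF nest_subset[OF iP] j]] by simp
  qed
  also have "\<dots> = (\<Sum>j\<in>nest P i. \<Sum>k\<in>nest_attrs P i t. ub P j k t * d j t)"
    using same by (simp add: sum_distrib_left mult.commute)
  also have "\<dots> = (\<Sum>k\<in>nest_attrs P i t. \<Sum>j\<in>nest P i. ub P j k t * d j t)"
    by (rule sum.swap)
  finally show ?thesis .
qed

text \<open>The shares stay as they are: each group of coordinates of \<open>v\<close> and \<open>u\<close> that enters one entropy
  constraint is raised separately by \<open>raise_to_total\<close>.  Lower bounds survive because no coordinate
  decreases.\<close>

lemma FP2_tightening:
  assumes cond_ii: "\<And>j t. j \<in> products_gt P \<Longrightarrow> t \<le> horizon P \<Longrightarrow> ub_attrs P j t \<subset> attrs P j t"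
    and feas: "(d, p, p0, v, u) \<in> FP2_feasible P"
  shows "\<exists>v' u'. (d, p, p0, v', u') \<in> FP2_feasible P \<and> FP2_tight P d p p0 v' \<and> gt_tight d p p0 u' \<and>
    (\<forall>t\<le>horizon P. \<forall>i\<in>nests_le P. \<forall>k. v i k t \<le> v' i k t) \<and>
    (\<forall>t\<le>horizon P. \<forall>j\<in>products_gt P. \<forall>k. u j k t \<le> u' j k t)"
proof -
  note F = feas[unfolded FP2_feasible_iff]
  let ?total = "\<lambda>i t. \<Sum>j\<in>nest P i. d j t * implied_total d p p0 i j t"
  define fills_nest where "fills_nest i t w \<longleftrightarrow> (\<forall>k. v i k t \<le> w k) \<and>
      (\<forall>k\<in>nest_ub_attrs P i t. w k \<le> (\<Sum>j\<in>nest P i. ub P j k t * d j t)) \<and>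
      (\<Sum>k\<in>nest_attrs P i t. w k) = ?total i t" for i t w
  have "\<exists>w. fills_nest i t w" if t: "t \<le> horizon P" and i: "i \<in> nests_le P" for i t
  proof -
    have iP: "i \<in> nests P" using i nests_le_subset by blast
    show ?thesis
      unfolding fills_nest_def
    proof (rule raise_to_total[OF finite_nest_attrs[OF iP t] nest_ub_attrs_subset[OF iP t]])
      show "v i k t \<le> (\<Sum>j\<in>nest P i. ub P j k t * d j t)" if "k \<in> nest_ub_attrs P i t" for k
        using F t i that by simp
      show "(\<Sum>k\<in>nest_attrs P i t. v i k t) \<le> ?total i t" using F t i by simp
    qed (rule FP2_nest_slack_fits_below_caps[OF feas t i])
  qed
  note fill = someI_ex[OF this]
  define v' where "v' t i = (SOME w. fills_nest i t w)" for t i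
  have "\<forall>t\<le>horizon P. \<forall>i. i \<in> nests_le P \<longrightarrow> fills_nest i t (v' t i)"
    using fill by (simp add: v'_def)
  note v' = this[unfolded fills_nest_def]
  define fills_product where "fills_product j t w \<longleftrightarrow> (\<forall>k. u j k t \<le> w k) \<and>
      (\<forall>k\<in>ub_attrs P j t. w k \<le> ub P j k t * d j t) \<and>
      (\<forall>i\<in>nests_gt P. j \<in> nest P i \<longrightarrow> (\<Sum>k\<in>attrs P j t. w k) = d j t * implied_total d p p0 i j t)"
    for j t w
  have "\<exists>w. fills_product j t w" if t: "t \<le> horizon P" and j: "j \<in> products_gt P" for j t
  proof -
    obtain i where i: "i \<in> nests_gt P" "j \<in> nest P i" using j by (auto simp: products_gt_def)
    have jP: "j \<in> products P" using j products_gt_subset by blast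
    have unique: "i' = i" if "i' \<in> nests_gt P" "j \<in> nest P i'" for i'
      using that i nest_disjoint nests_gt_subset unfolding disjoint_family_on_def by blast
    have "\<exists>w. (\<forall>k. u j k t \<le> w k) \<and> (\<forall>k\<in>ub_attrs P j t. w k \<le> ub P j k t * d j t) \<and>
        sum w (attrs P j t) = d j t * implied_total d p p0 i j t"
    proof (rule raise_to_total[OF finite_attrs[OF jP t] ub_attrs_subset[OF jP t]])
      show "u j k t \<le> ub P j k t * d j t" if "k \<in> ub_attrs P j t" for k
        using F t j that by (simp add: within_bounds_def)
      show "(\<Sum>k\<in>attrs P j t. u j k t) \<le> d j t * implied_total d p p0 i j t" using F t i by simp
    qed (use cond_ii[OF j t] in simp)
    then obtain w where w: "\<forall>k. u j k t \<le> w k" "\<forall>k\<in>ub_attrs P j t. w k \<le> ub P j k t * d j t"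
        "sum w (attrs P j t) = d j t * implied_total d p p0 i j t" by blast
    have "\<forall>i'\<in>nests_gt P. j \<in> nest P i' \<longrightarrow> sum w (attrs P j t) = d j t * implied_total d p p0 i' j t"
      using unique w(3) by metis
    with w(1,2) show ?thesis unfolding fills_product_def by blast
  qed
  note fill = someI_ex[OF this]
  define u' where "u' t j = (SOME w. fills_product j t w)" for t j
  have "\<forall>t\<le>horizon P. \<forall>j. j \<in> products_gt P \<longrightarrow> fills_product j t (u' t j)"
    using fill by (simp add: u'_def)
  note u' = this[unfolded fills_product_def]
  define V where "V i k t = v' t i k" for i k t
  define U where "U j k t = u' t j k" for j k t
  have V: "v i k t \<le> V i k t" "(\<Sum>k\<in>nest_attrs P i t. V i k t) = ?total i t"
    "k' \<in> nest_ub_attrs P i t \<Longrightarrow> V i k' t \<le> (\<Sum>j\<in>nest P i. ub P j k' t * d j t)"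
    if "t \<le> horizon P" "i \<in> nests_le P" for i k k' t
    using v' that by (simp_all add: V_def)
  have U: "u j k t \<le> U j k t" "k' \<in> ub_attrs P j t \<Longrightarrow> U j k' t \<le> ub P j k' t * d j t"
    if "t \<le> horizon P" "j \<in> products_gt P" for j k k' t
    using u' that by (simp_all add: U_def)
  have U_total: "(\<Sum>k\<in>attrs P j t. U j k t) = d j t * implied_total d p p0 i j t"
    if "t \<le> horizon P" "i \<in> nests_gt P" "j \<in> nest P i" for i j t
  proof -
    have "j \<in> products_gt P" using that by (auto simp: products_gt_def)
    then show ?thesis using u' that by (simp add: U_def)
  qed
  have "(d, p, p0, V, U) \<in> FP2_feasible P"
    unfolding FP2_feasible_iff
  proof (intro conjI allI impI ballI, goal_cases)
    \<comment> \<open>Lower bounds on the aggregated variables.\<close>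
    case (6 t i k)
    then have "(\<Sum>j\<in>nest P i. lb P j k t * d j t) \<le> v i k t" using F by simp
    also have "\<dots> \<le> V i k t" using V(1) 6 by blast
    finally show ?case .
  next
    \<comment> \<open>Bounds on the variables that are not aggregated.\<close>
    case (8 t)
    then have "within_bounds (products_gt P) d u t" using F by simp
    then show ?case using U[OF 8] unfolding within_bounds_def by (meson order_trans)
  qed (use F V(2,3) U_total in auto)
  moreover have "FP2_tight P d p p0 V" using F V(2) by (simp add: FP2_tight_iff)
  moreover have "gt_tight d p p0 U" using U_total by (simp add: gt_tight_def)
  ultimately show ?thesis using V(1) U(1) by blast
qed

text \<open>The equalities make the monotonicity strict: as every \<open>phi\<close> and \<open>arrivals\<close> is positive, no
  relevant coordinate can be raised without a gain.\<close>

lemma FP2_objective_mono: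
  assumes v: "\<forall>t\<le>horizon P. \<forall>i\<in>nests_le P. \<forall>k. v i k t \<le> v' i k t"
    and u: "\<forall>t\<le>horizon P. \<forall>j\<in>products_gt P. \<forall>k. u j k t \<le> u' j k t"
  shows "FP2_objective P (d, p, p0, v, u) \<le> FP2_objective P (d, p, p0, v', u')"
    and "\<lbrakk>FP2_objective P (d, p, p0, v', u') \<le> FP2_objective P (d, p, p0, v, u);
      t \<le> horizon P; i \<in> nests_le P; k \<in> nest_attrs P i t\<rbrakk> \<Longrightarrow> v i k t = v' i k t"
    and "\<lbrakk>FP2_objective P (d, p, p0, v', u') \<le> FP2_objective P (d, p, p0, v, u);
      t \<le> horizon P; j \<in> products_gt P; m \<in> attrs P j t\<rbrakk> \<Longrightarrow> u j m t = u' j m t"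
proof -
  let ?a = "\<lambda>v t i. \<Sum>k\<in>nest_attrs P i t. phi P k t * v i k t"
  let ?b = "\<lambda>u t j. \<Sum>k\<in>attrs P j t. phi P k t * u j k t"
  let ?A = "\<lambda>v t. \<Sum>i\<in>nests_le P. ?a v t i"
  let ?B = "\<lambda>u t. \<Sum>j\<in>products_gt P. ?b u t j"
  have fin: "finite (nests_le P)" "finite (products_gt P)"
    using finite_nests nests_le_subset finite_products products_gt_subset by (auto intro: finite_subset)
  have phi_le: "0 < phi P k t" if "t \<le> horizon P" "i \<in> nests_le P" "k \<in> nest_attrs P i t" for t i k
    using nest_attr_phi_pos that nests_le_subset by blast
  have phi_gt: "0 < phi P k t" if "t \<le> horizon P" "j \<in> products_gt P" "k \<in> attrs P j t" for t j k
    using phi_pos that products_gt_subset by blast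
  have a: "?a v t i \<le> ?a v' t i" if "t \<le> horizon P" "i \<in> nests_le P" for t i
    using that v phi_le by (intro sum_mono mult_left_mono) (auto intro: less_imp_le)
  have b: "?b u t j \<le> ?b u' t j" if "t \<le> horizon P" "j \<in> products_gt P" for t j
    using that u phi_gt by (intro sum_mono mult_left_mono) (auto intro: less_imp_le)
  have A: "arrivals P t * ?A v t \<le> arrivals P t * ?A v' t" if "t \<le> horizon P" for t
    using that a arrivals_pos[OF that] by (intro mult_left_mono sum_mono[of "nests_le P"]) auto
  have B: "arrivals P t * ?B u t \<le> arrivals P t * ?B u' t" if "t \<le> horizon P" for t
    using that b arrivals_pos[OF that] by (intro mult_left_mono sum_mono[of "products_gt P"]) auto
  have sums: "(\<Sum>t\<le>horizon P. arrivals P t * ?A v t) \<le> (\<Sum>t\<le>horizon P. arrivals P t * ?A v' t)"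
      "(\<Sum>t\<le>horizon P. arrivals P t * ?B u t) \<le> (\<Sum>t\<le>horizon P. arrivals P t * ?B u' t)"
    using A B by (auto intro: sum_mono)
  then show "FP2_objective P (d, p, p0, v, u) \<le> FP2_objective P (d, p, p0, v', u')"
    by (simp add: FP2_objective_def)
  assume "FP2_objective P (d, p, p0, v', u') \<le> FP2_objective P (d, p, p0, v, u)"
    and t: "t \<le> horizon P"
  then have eqs: "(\<Sum>t\<le>horizon P. arrivals P t * ?A v t) = (\<Sum>t\<le>horizon P. arrivals P t * ?A v' t)"
      "(\<Sum>t\<le>horizon P. arrivals P t * ?B u t) = (\<Sum>t\<le>horizon P. arrivals P t * ?B u' t)"
    using sums by (auto simp: FP2_objective_def)
  have "?A v t = ?A v' t" "?B u t = ?B u' t"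
    using sum_mono_inv[OF eqs(1) A, of t] sum_mono_inv[OF eqs(2) B, of t] t arrivals_pos[OF t] by auto
  then have ab: "i \<in> nests_le P \<Longrightarrow> ?a v t i = ?a v' t i" "j \<in> products_gt P \<Longrightarrow> ?b u t j = ?b u' t j" for i j
    using sum_mono_inv[of "?a v t" "nests_le P" "?a v' t" i] sum_mono_inv[of "?b u t" "products_gt P" "?b u' t" j]
      a b t fin by blast+
  show "v i k t = v' i k t" if i: "i \<in> nests_le P" and k: "k \<in> nest_attrs P i t"
    using sum_mono_inv[OF ab(1)[OF i], of k] v phi_le[OF t i] k
      finite_nest_attrs[of i t] i t nests_le_subset by (force intro: mult_left_mono)
  show "u j m t = u' j m t" if j: "j \<in> products_gt P" and m: "m \<in> attrs P j t"
    using sum_mono_inv[OF ab(2)[OF j], of m] u phi_gt[OF t j] m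
      finite_attrs[of j t] j t products_gt_subset by (force intro: mult_left_mono)
qed

text \<open>Tightening an optimal solution gains nothing, hence changes no relevant coordinate.\<close>

lemma optimal_FP2_is_tight:
  assumes cond_ii: "\<And>j t. j \<in> products_gt P \<Longrightarrow> t \<le> horizon P \<Longrightarrow> ub_attrs P j t \<subset> attrs P j t"
    and opt: "optimal_solution (FP2_objective P) (FP2_feasible P) (d, p, p0, v, u)"
  shows "FP2_tight P d p p0 v" "gt_tight d p p0 u"
proof -
  have feas: "(d, p, p0, v, u) \<in> FP2_feasible P" using opt by (simp add: optimal_solution_def is_arg_max_def)
  then have shares: "\<And>t. t \<le> horizon P \<Longrightarrow> interior_shares d p p0 t" by (simp add: FP2_feasible_iff)
  obtain v' u' where T: "(d, p, p0, v', u') \<in> FP2_feasible P"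
    "FP2_tight P d p p0 v'" "gt_tight d p p0 u'"
    "\<forall>t\<le>horizon P. \<forall>i\<in>nests_le P. \<forall>k. v i k t \<le> v' i k t"
    "\<forall>t\<le>horizon P. \<forall>j\<in>products_gt P. \<forall>k. u j k t \<le> u' j k t"
    using FP2_tightening[OF cond_ii feas] by blast
  have "FP2_objective P (d, p, p0, v', u') \<le> FP2_objective P (d, p, p0, v, u)"
    using opt T(1) by (auto simp: optimal_solution_def is_arg_max_linorder)
  note eq = FP2_objective_mono(2,3)[OF T(4,5) this]
  show "FP2_tight P d p p0 v" using T(2) eq(1) by (simp add: FP2_tight_iff[OF shares])
  have "(\<Sum>k\<in>attrs P j t. u j k t) = (\<Sum>k\<in>attrs P j t. u' j k t)"
    if "t \<le> horizon P" "i \<in> nests_gt P" "j \<in> nest P i" for t i j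
    using eq(2)[OF that(1), of j] that by (intro sum.cong) (auto simp: products_gt_def)
  with T(3) show "gt_tight d p p0 u" by (simp add: gt_tight_def)
qed

end

section \<open>Equivalence of the two problems\<close>

theorem theorem3p8:
  fixes P :: "('j, 'r, 'i, 'k) nl_data"
  assumes "nested_logit P"
    and cond_i: "\<And>d p p0 v u. (d, p, p0, v, u) \<in> FP2_feasible P \<Longrightarrow> FP2_tight P d p p0 v
      \<Longrightarrow> \<exists>u_le. disaggregates P d p p0 v u_le"
    and cond_ii: "\<And>j t. j \<in> products_gt P \<Longrightarrow> t \<le> horizon P \<Longrightarrow> ub_attrs P j t \<subset> attrs P j t"
  shows "(FP2_feasible P = {} \<longrightarrow> FP1_feasible P = {})
    \<and> (unbounded_problem (FP2_objective P) (FP2_feasible P)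
        \<longrightarrow> unbounded_problem (FP1_objective P) (FP1_feasible P))
    \<and> (\<forall>d p p0 v u_gt.
        optimal_solution (FP2_objective P) (FP2_feasible P) (d, p, p0, v, u_gt) \<longrightarrow>
        (\<exists>u_le. disaggregates P d p p0 v u_le) \<and>
        (\<forall>u_le x. disaggregates P d p p0 v u_le \<and>
          (\<forall>t\<le>horizon P. \<forall>j\<in>products_le P. \<forall>k\<in>attrs P j t. x j k t = u_le j k t / d j t) \<and>
          (\<forall>t\<le>horizon P. \<forall>j\<in>products_gt P. \<forall>k\<in>attrs P j t. x j k t = u_gt j k t / d j t) \<longrightarrow>
          optimal_solution (FP1_objective P) (FP1_feasible P) (d, p, x)))"
proof -
  interpret nested_logit P by fact
  have embed: "\<exists>s\<in>FP2_feasible P. FP2_objective P s = FP1_objective P z" if "z \<in> FP1_feasible P" for z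
    using that FP1_embeds_in_FP2 by (cases z) metis
  have recover: "\<exists>z\<in>FP1_feasible P. FP2_objective P s \<le> FP1_objective P z" if "s \<in> FP2_feasible P" for s
  proof -
    obtain d p p0 v u where s: "s = (d, p, p0, v, u)" by (cases s)
    with that have feas: "(d, p, p0, v, u) \<in> FP2_feasible P" by simp
    obtain v' u' where T: "(d, p, p0, v', u') \<in> FP2_feasible P"
      "FP2_tight P d p p0 v'" "gt_tight d p p0 u'"
      "\<forall>t\<le>horizon P. \<forall>i\<in>nests_le P. \<forall>k. v i k t \<le> v' i k t"
      "\<forall>t\<le>horizon P. \<forall>j\<in>products_gt P. \<forall>k. u j k t \<le> u' j k t"
      using FP2_tightening[OF cond_ii feas] by blast
    obtain u_le where dis: "disaggregates P d p p0 v' u_le" using cond_i T by blast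
    define x where "x j k t = (if j \<in> products_le P then u_le j k t else u' j k t) / d j t" for j k t
    have x: "x j k t = u_le j k t / d j t" if "j \<in> products_le P" for j k t
      using that by (simp add: x_def)
    have x': "x j k t = u' j k t / d j t" if "j \<in> products_gt P" for j k t
      using that products_le_gt_disjoint by (auto simp: x_def)
    have "(d, p, x) \<in> FP1_feasible P" "FP1_objective P (d, p, x) = FP2_objective P (d, p, p0, v', u')"
      using tight_FP2_solution_yields_FP1_solution[OF T(1,3) dis x x'] by simp_all
    moreover have "FP2_objective P s \<le> FP2_objective P (d, p, p0, v', u')"
      unfolding s by (rule FP2_objective_mono(1)[OF T(4,5)])
    ultimately show ?thesis by (intro bexI[of _ "(d, p, x)"]) simp_all
  qed
  have unbounded: "unbounded_problem (FP1_objective P) (FP1_feasible P)"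
    if "unbounded_problem (FP2_objective P) (FP2_feasible P)"
  proof -
    have "FP1_feasible P \<noteq> {}" using that recover by (auto simp: unbounded_problem_def)
    moreover have "bdd_above (FP2_objective P ` FP2_feasible P)"
      if bdd: "bdd_above (FP1_objective P ` FP1_feasible P)"
    proof -
      obtain M where M: "\<And>z. z \<in> FP1_feasible P \<Longrightarrow> FP1_objective P z \<le> M"
        using bdd by (auto simp: bdd_above_def simp del: split_paired_All)
      have "FP2_objective P s \<le> M" if "s \<in> FP2_feasible P" for s
        using recover[OF that] M order_trans by blast
      then show ?thesis by (intro bdd_aboveI2)
    qed
    ultimately show ?thesis using that unfolding unbounded_problem_def by blast
  qed
  have optimal: "(\<exists>u_le. disaggregates P d p p0 v u_le) \<and>
        (\<forall>u_le x. disaggregates P d p p0 v u_le \<and>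
          (\<forall>t\<le>horizon P. \<forall>j\<in>products_le P. \<forall>k\<in>attrs P j t. x j k t = u_le j k t / d j t) \<and>
          (\<forall>t\<le>horizon P. \<forall>j\<in>products_gt P. \<forall>k\<in>attrs P j t. x j k t = u_gt j k t / d j t) \<longrightarrow>
          optimal_solution (FP1_objective P) (FP1_feasible P) (d, p, x))"
    if opt: "optimal_solution (FP2_objective P) (FP2_feasible P) (d, p, p0, v, u_gt)" for d p p0 v u_gt
  proof (intro conjI allI impI; (elim conjE)?)
    have feas: "(d, p, p0, v, u_gt) \<in> FP2_feasible P"
      and best: "\<And>s. s \<in> FP2_feasible P \<Longrightarrow> FP2_objective P s \<le> FP2_objective P (d, p, p0, v, u_gt)"
      using opt by (auto simp: optimal_solution_def is_arg_max_linorder)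
    note tight = optimal_FP2_is_tight[OF cond_ii opt]
    show "\<exists>u_le. disaggregates P d p p0 v u_le" using cond_i feas tight(1) by blast
    fix u_le x
    assume dis: "disaggregates P d p p0 v u_le"
      and "\<forall>t\<le>horizon P. \<forall>j\<in>products_le P. \<forall>k\<in>attrs P j t. x j k t = u_le j k t / d j t"
      and "\<forall>t\<le>horizon P. \<forall>j\<in>products_gt P. \<forall>k\<in>attrs P j t. x j k t = u_gt j k t / d j t"
    then have "(d, p, x) \<in> FP1_feasible P"
      "FP1_objective P (d, p, x) = FP2_objective P (d, p, p0, v, u_gt)"
      using tight_FP2_solution_yields_FP1_solution[OF feas tight(2) dis, of x] by simp_all
    then show "optimal_solution (FP1_objective P) (FP1_feasible P) (d, p, x)"
      unfolding optimal_solution_def is_arg_max_linorder using best embed by metis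
  qed
  show ?thesis using embed unbounded optimal by blast
qed

end
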